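(* Let $E$ be a finite set, $p \in (0,1)$, and let $k$ be a positive integer. For any integer $h \ge 1$, any $k$-exchange system $\mathcal{D} \subseteq 2^E$ admits an $(\alpha_h,\beta_h)$-uniform exchange map, where \[ \alpha_h = \frac{p^h}{h}, \qquad \beta_h = \frac{p^h}{h}\cdot\left(k - 1 + \frac1h\right). \]
   Context: A hereditary (closed under taking subsets) set system $\mathcal{D} \subseteq 2^E$ is a $k$-exchange system if for every $X, Y \in \mathcal{D}$ there is a collection of subsets $\{T_y\}_{y \in Y \setminus X}$ of $X \setminus Y$ such that (1) $|T_y| \le k$ for each $y$; (2) each $x \in X \setminus Y$ appears at most $k$ times in the collection; (3) for every $S \subseteq Y \setminus X$, $(X \cup S) \setminus \bigcup_{y \in S} T_y \in \mathcal{D}$. Exchange maps: for $X, Y \in \mathcal{D}$, an exchange map between $X$ and $Y$ is a pair of (possibly random) functions $S_{X,Y} \colon 2^{Y \setminus X} \to 2^{Y \setminus X}$ and $T_{X,Y} \colon 2^{Y \setminus X} \to 2^{X \setminus Y}$ such that for every $R \subseteq Y \setminus X$: (1) $S_{X,Y}(R) \subseteq R$, and (2) $(X \cup S_{X,Y}(R)) \setminus T_{X,Y}(R) \in \mathcal{D}$. It is $(\alpha,\beta)$-uniform if $\Pr(y \in S_{X,Y}(R)) \ge \alpha$ for all $y \in Y \setminus X$ and $\Pr(x \in T_{X,Y}(R)) \le \beta$ for all $x \in X \setminus Y$, where the probability is over the random set $R \subseteq Y \setminus X$ containing each $y \in Y\setminus X$ independently with probability $p$ (and any internal randomness of the map).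 $\mathcal{D}$ admits an $(\alpha,\beta)$-uniform exchange map if there is an $(\alpha,\beta)$-uniform exchange map between $X$ and $Y$ for all $X, Y \in \mathcal{D}$.
   Formalization: The case k = 1 with h ≥ 2 is excluded, since the claim is false there: for D = {∅,{a},{b}}, X = {a}, Y = {b}, inserting b forces removing a, so α_h ≤ β_h would be needed, but p^h/h > p^h/h². *)

theory Defs
  imports "HOL-Probability.Probability"
begin

definition hereditary :: "'a set set \<Rightarrow> bool" where
  "hereditary D \<longleftrightarrow> (\<forall>A\<in>D. \<forall>B. B \<subseteq> A \<longrightarrow> B \<in> D)"

definition k_exchange_system :: "'a set \<Rightarrow> nat \<Rightarrow> 'a set set \<Rightarrow> bool" where
  "k_exchange_system E k D \<longleftrightarrow>
     D \<subseteq> Pow E \<and> hereditary D \<and>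
     (\<forall>X\<in>D. \<forall>Y\<in>D. \<exists>T :: 'a \<Rightarrow> 'a set.
        (\<forall>y\<in>Y - X. T y \<subseteq> X - Y \<and> card (T y) \<le> k) \<and>
        (\<forall>x\<in>X - Y. card {y \<in> Y - X. x \<in> T y} \<le> k) \<and>
        (\<forall>S. S \<subseteq> Y - X \<longrightarrow> (X \<union> S) - (\<Union>y\<in>S. T y) \<in> D))"

definition is_exchange_map ::
  "'a set set \<Rightarrow> 'a set \<Rightarrow> 'a set \<Rightarrow> ('a set \<Rightarrow> 'a set) \<Rightarrow> ('a set \<Rightarrow> 'a set) \<Rightarrow> bool" where
  "is_exchange_map D X Y S T \<longleftrightarrow>
     (\<forall>R. R \<subseteq> Y - X \<longrightarrow>
        S R \<subseteq> R \<and> T R \<subseteq> X - Y \<and> (X \<union> S R) - T R \<in> D)"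

text \<open>A random exchange map is a probability distribution over pairs of functions, almost every
  one of which is an exchange map. Only the values on the finite set \<open>Pow (Y - X)\<close> matter, so
  discrete distributions suffice; a deterministic map is \<open>return_pmf (S, T)\<close>.\<close>

definition random_exchange_map ::
  "'a set set \<Rightarrow> 'a set \<Rightarrow> 'a set \<Rightarrow> (('a set \<Rightarrow> 'a set) \<times> ('a set \<Rightarrow> 'a set)) pmf \<Rightarrow> bool" where
  "random_exchange_map D X Y M \<longleftrightarrow> (\<forall>(S, T)\<in>set_pmf M. is_exchange_map D X Y S T)"

text \<open>The random subset of \<open>A\<close> (for finite \<open>A\<close>) that contains each element independently with
  probability \<open>p\<close>.\<close>

definition random_subset_pmf :: "real \<Rightarrow> 'a set \<Rightarrow> 'a set pmf" where
  "random_subset_pmf p A =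
     map_pmf (\<lambda>f. {a \<in> A. f a}) (Pi_pmf A False (\<lambda>_. bernoulli_pmf p))"

text \<open>The internal randomness of the map is independent of the random set \<open>R\<close>, hence the product
  distribution.\<close>

definition uniform_exchange_map ::
  "real \<Rightarrow> real \<Rightarrow> real \<Rightarrow> 'a set \<Rightarrow> 'a set \<Rightarrow>
     (('a set \<Rightarrow> 'a set) \<times> ('a set \<Rightarrow> 'a set)) pmf \<Rightarrow> bool" where
  "uniform_exchange_map p \<alpha> \<beta> X Y M \<longleftrightarrow>
     (let P = measure_pmf.prob (pair_pmf (random_subset_pmf p (Y - X)) M) in
       (\<forall>y\<in>Y - X. P {(R, (S, T)). y \<in> S R} \<ge> \<alpha>) \<and>
       (\<forall>x\<in>X - Y. P {(R, (S, T)). x \<in> T R} \<le> \<beta>))"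

definition admits_uniform_exchange_map ::
  "real \<Rightarrow> real \<Rightarrow> real \<Rightarrow> 'a set set \<Rightarrow> bool" where
  "admits_uniform_exchange_map p \<alpha> \<beta> D \<longleftrightarrow>
     (\<forall>X\<in>D. \<forall>Y\<in>D. \<exists>M. random_exchange_map D X Y M \<and> uniform_exchange_map p \<alpha> \<beta> X Y M)"

text \<open>For \<open>k = 1\<close> and \<open>h \<ge> 2\<close> the bounds \<open>p^h / h\<close> and \<open>p^h / h * (k - 1 + 1 / h)\<close> are not
  attainable: in the 1-exchange system below, whenever \<open>False\<close> is inserted into \<open>{True}\<close>, the
  element \<open>True\<close> has to be removed, which forces \<open>\<alpha> \<le> \<beta>\<close>.\<close>

lemma one_exchange_counterexample:
  fixes p :: real and h :: nat
  assumes "0 < p" "h \<ge> 2"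
  shows "\<exists>D :: bool set set. k_exchange_system UNIV 1 D \<and>
    \<not> admits_uniform_exchange_map p (p ^ h / real h) (p ^ h / real h * (real 1 - 1 + 1 / real h)) D"
proof (intro exI conjI)
  let ?D = "{{}, {True}, {False}} :: bool set set"
  let ?\<alpha> = "p ^ h / real h" and ?\<beta> = "p ^ h / real h * (real 1 - 1 + 1 / real h)"
  have sub: "S = {} \<or> S = {b}" if "S \<subseteq> {b}" for S :: "bool set" and b
    using that by blast
  have "\<exists>T :: bool \<Rightarrow> bool set.
        (\<forall>y\<in>Y - X. T y \<subseteq> X - Y \<and> card (T y) \<le> 1) \<and>
        (\<forall>x\<in>X - Y. card {y \<in> Y - X. x \<in> T y} \<le> 1) \<and>
        (\<forall>S. S \<subseteq> Y - X \<longrightarrow> (X \<union> S) - (\<Union>y\<in>S. T y) \<in> ?D)" if "X \<in> ?D" "Y \<in> ?D" for X Y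
  proof (intro exI[of _ "\<lambda>_. X - Y"] conjI ballI allI impI)
    fix y assume "y \<in> Y - X"
    show "card (X - Y) \<le> 1" using that by auto
  next
    fix x assume "x \<in> X - Y"
    have "card {y \<in> Y - X. x \<in> X - Y} \<le> card Y" by (rule card_mono) auto
    also have "\<dots> \<le> 1" using that by auto
    finally show "card {y \<in> Y - X. x \<in> X - Y} \<le> 1" .
  next
    fix S assume S: "S \<subseteq> Y - X"
    show "(X \<union> S) - (\<Union>y\<in>S. X - Y) \<in> ?D"
    proof (cases "S = {}")
      case True
      then show ?thesis using that by simp
    next
      case False
      then have "S = Y" "X \<inter> Y = {}" using S that by auto
      then have "(X \<union> S) - (\<Union>y\<in>S. X - Y) = Y" using False by auto
      then show ?thesis using that by simp
    qed
  qed auto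
  moreover have "hereditary ?D"
    unfolding hereditary_def using sub by auto
  ultimately show "k_exchange_system UNIV 1 ?D"
    unfolding k_exchange_system_def Pow_UNIV by (intro conjI ballI subset_UNIV)
  have less: "?\<beta> < ?\<alpha>"
    using assms by (simp add: field_simps)
  show "\<not> admits_uniform_exchange_map p ?\<alpha> ?\<beta> ?D"
  proof
    assume "admits_uniform_exchange_map p ?\<alpha> ?\<beta> ?D"
    then obtain M where M: "random_exchange_map ?D {True} {False} M"
      "uniform_exchange_map p ?\<alpha> ?\<beta> {True} {False} M"
      unfolding admits_uniform_exchange_map_def by blast
    let ?Q = "pair_pmf (random_subset_pmf p ({False} - {True})) M"
    have "measure_pmf.prob ?Q {(R, (S, T)). False \<in> S R} \<le> measure_pmf.prob ?Q {(R, (S, T)). True \<in> T R}"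
    proof (rule measure_pmf.finite_measure_mono_AE)
      show "AE z in measure_pmf ?Q. z \<in> {(R, (S, T)). False \<in> S R} \<longrightarrow> z \<in> {(R, (S, T)). True \<in> T R}"
      proof (rule AE_pmfI, clarify)
        fix R S T
        assume *: "(R, S, T) \<in> set_pmf ?Q" "False \<in> S R"
        then have "R \<subseteq> {False} - {True}" by (auto simp: random_subset_pmf_def)
        moreover have "is_exchange_map ?D {True} {False} S T"
          using M(1) * by (auto simp: random_exchange_map_def)
        ultimately have "({True} \<union> S R) - T R \<in> ?D" "T R \<subseteq> {True}"
          unfolding is_exchange_map_def by auto
        then show "True \<in> T R" using \<open>False \<in> S R\<close> by auto
      qed
    qed auto
    moreover have "?\<alpha> \<le> measure_pmf.prob ?Q {(R, (S, T)). False \<in> S R}"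
      "measure_pmf.prob ?Q {(R, (S, T)). True \<in> T R} \<le> ?\<beta>"
      using M(2) unfolding uniform_exchange_map_def Let_def by auto
    ultimately show False using less by linarith
  qed
qed

end

theory Submission
  imports Defs "HOL-Combinatorics.Permutations"
begin

text \<open>Join \<open>y \<in> Y - X\<close> to the elements of \<open>T y\<close>; this bipartite graph has maximum degree \<open>k\<close>. For
  \<open>k \<ge> 2\<close>, Hall's theorem applied twice gives every \<open>x\<close> of degree \<open>k\<close> two distinct neighbours
  \<open>a x \<noteq> b x\<close> with \<open>a\<close> and \<open>b\<close> injective, so some permutation \<open>\<sigma>\<close> of \<open>Y - X\<close> maps \<open>a x\<close> to \<open>b x\<close>. The
  segments of \<open>h\<close> consecutive elements of the cycles of \<open>\<sigma>\<close> are blocks such that every \<open>y\<close> lies in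
  exactly \<open>h\<close> of them; since consecutive elements share \<open>h - 1\<close> blocks, every \<open>x\<close> has a neighbour in at
  most \<open>(k - 1) * h + 1\<close> blocks. A block meets at most \<open>h * (h - 1)\<close> others, so \<open>h\<^sup>2\<close> colours suffice to
  make blocks of the same colour disjoint. Choose a colour uniformly and insert the blocks of that
  colour contained in \<open>R\<close>: each block is used with probability \<open>p ^ h / h\<^sup>2\<close>, and summing over the
  blocks containing \<open>y\<close>, respectively meeting the neighbourhood of \<open>x\<close>, gives the two bounds.\<close>

section \<open>Matchings and colourings\<close>

text \<open>Induction on the total size of the sets: while some \<open>F i\<close> has two elements,
  one of them can be deleted without losing Hall's condition. Once all sets are singletons, the
  condition for pairs of indices makes them distinct.\<close>

theorem Hall_marriage:
  fixes F :: "'i \<Rightarrow> 'b set"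
  assumes "finite I" and "\<And>i. i \<in> I \<Longrightarrow> finite (F i)"
    and "\<And>J. J \<subseteq> I \<Longrightarrow> card J \<le> card (\<Union>j\<in>J. F j)"
  shows "\<exists>f. inj_on f I \<and> (\<forall>i\<in>I. f i \<in> F i)"
  using assms(2,3)
proof (induction "\<Sum>i\<in>I. card (F i)" arbitrary: F rule: less_induct)
  case less
  show ?case
  proof (cases "\<exists>i\<in>I. card (F i) \<noteq> 1")
    case False
    then have "\<forall>i\<in>I. \<exists>z. F i = {z}" by (simp add: card_1_singleton_iff)
    then obtain f where f: "\<And>i. i \<in> I \<Longrightarrow> F i = {f i}" by metis
    have "inj_on f I"
    proof (rule inj_onI, rule ccontr)
      fix i j assume ij: "i \<in> I" "j \<in> I" "f i = f j" "i \<noteq> j"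
      then show False using less.prems(2)[of "{i, j}"] f[of i] f[of j] by auto
    qed
    with f show ?thesis by auto
  next
    case True
    then obtain i where i: "i \<in> I" "card (F i) \<noteq> 1" by blast
    have "1 \<le> card (F i)" using less.prems(2)[of "{i}"] i by simp
    with i have "2 \<le> card (F i)" by simp
    then obtain A where "A \<subseteq> F i" "card A = 2" by (rule obtain_subset_with_card_n)
    then obtain x y where xy: "x \<in> F i" "y \<in> F i" "x \<noteq> y" by (auto simp: card_2_iff)
    define U where "U = (\<lambda>J. \<Union>j\<in>J. F j)"
    have finU: "finite (U J)" if "J \<subseteq> I" for J
      unfolding U_def using finite_subset[OF that assms(1)] that less.prems(1) by auto
    define G where "G = (\<lambda>z. F(i := F i - {z}))"
    have "\<exists>f. inj_on f I \<and> (\<forall>j\<in>I. f j \<in> F j)"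
      if z: "z \<in> F i" and hall: "\<And>J. J \<subseteq> I \<Longrightarrow> card J \<le> card (\<Union>j\<in>J. G z j)" for z
    proof -
      have "(\<Sum>j\<in>I. card (G z j)) < (\<Sum>j\<in>I. card (F j))"
      proof (rule sum_strict_mono_ex1[OF assms(1)])
        show "\<forall>j\<in>I. card (G z j) \<le> card (F j)"
          using less.prems(1) by (simp add: G_def card_Diff1_le)
        have "card (F i - {z}) < card (F i)"
          by (rule card_Diff1_less[OF less.prems(1)[OF i(1)] z])
        then show "\<exists>j\<in>I. card (G z j) < card (F j)" using i by (auto simp: G_def)
      qed
      moreover have "finite (G z j)" if "j \<in> I" for j
        using less.prems(1) that i(1) by (simp add: G_def)
      ultimately obtain f where "inj_on f I" "\<forall>j\<in>I. f j \<in> G z j"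
        using less.hyps[OF _ _ hall] by blast
      then show ?thesis by (auto simp: G_def split: if_splits)
    qed
    text \<open>Rado's argument: if neither \<open>x\<close> nor \<open>y\<close> could be deleted from \<open>F i\<close>, the two violating
      index sets would contradict submodularity of \<open>J \<mapsto> card (\<Union>j\<in>J. F j)\<close>.\<close>
    moreover have "\<exists>z\<in>{x, y}. \<forall>J\<subseteq>I. card J \<le> card (\<Union>j\<in>J. G z j)"
    proof (rule ccontr)
      assume *: "\<not> ?thesis"
      \<comment> \<open>A violating index set contains \<open>i\<close>, since \<open>G z\<close>
        agrees with \<open>F\<close> elsewhere. Taking \<open>i\<close> out of it turns the strict
        inequality into a weak one.\<close>
      have small: "\<exists>J\<subseteq>I - {i}. card ((F i - {z}) \<union> U J) \<le> card J" if z: "z \<in> {x, y}" for z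
      proof -
        obtain J where J: "J \<subseteq> I" "card (\<Union>j\<in>J. G z j) < card J"
          using * z by (auto simp: not_le)
        have "i \<in> J"
        proof (rule ccontr)
          assume "i \<notin> J"
          then have "(\<Union>j\<in>J. G z j) = (\<Union>j\<in>J. F j)" by (auto simp: G_def)
          with J less.prems(2)[of J] show False by simp
        qed
        then have "(\<Union>j\<in>J. G z j) = (F i - {z}) \<union> U (J - {i})"
          by (auto simp: G_def U_def split: if_splits)
        moreover have "card J = Suc (card (J - {i}))"
          using \<open>i \<in> J\<close> J(1) assms(1) by (metis card_Suc_Diff1 finite_subset)
        ultimately show ?thesis using J by (intro exI[of _ "J - {i}"]) auto
      qed
      obtain J1 where J1: "J1 \<subseteq> I - {i}" "card ((F i - {x}) \<union> U J1) \<le> card J1"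
        using small[of x] by auto
      obtain J2 where J2: "J2 \<subseteq> I - {i}" "card ((F i - {y}) \<union> U J2) \<le> card J2"
        using small[of y] by auto
      let ?P = "(F i - {x}) \<union> U J1" and ?Q = "(F i - {y}) \<union> U J2"
      have fin: "finite J1" "finite J2" "finite ?P" "finite ?Q"
        using J1(1) J2(1) assms(1) finU[of J1] finU[of J2] less.prems(1)[of i] i
        by (auto intro: finite_subset)
      \<comment> \<open>As \<open>x \<noteq> y\<close>, the two punctured copies of
        \<open>F i\<close> together give back all of \<open>F i\<close>, so the index
        \<open>i\<close> counts again in the union. This extra one contradicts the two weak
        bounds.\<close>
      have "?P \<union> ?Q = U (insert i (J1 \<union> J2))"
        using xy by (auto simp: U_def)
      then have 1: "Suc (card (J1 \<union> J2)) \<le> card (?P \<union> ?Q)"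
        using less.prems(2)[of "insert i (J1 \<union> J2)"] J1(1) J2(1) i fin
        by (auto simp: U_def subset_Diff_insert)
      have "card (J1 \<inter> J2) \<le> card (U (J1 \<inter> J2))"
        using less.prems(2)[of "J1 \<inter> J2"] J1(1) unfolding U_def by blast
      also have "\<dots> \<le> card (?P \<inter> ?Q)"
        using fin by (intro card_mono) (auto simp: U_def)
      finally show False
        using 1 J1(2) J2(2) card_Un_Int[OF fin(1,2)] card_Un_Int[OF fin(3,4)] by linarith
    qed
    ultimately show ?thesis using xy by blast
  qed
qed

section \<open>Matchings in graphs of bounded degree\<close>

text \<open>Double counting gives Hall's condition for the support of \<open>w\<close>: the rows in
  \<open>J\<close> carry weight \<open>k * card J\<close>, all of it in the columns they reach, and
  each column has room for only \<open>k\<close>.\<close>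

lemma regular_matrix_permutation:
  fixes w :: "'a \<Rightarrow> 'a \<Rightarrow> nat"
  assumes fin: "finite V" and "k > 0"
    and row: "\<And>u. u \<in> V \<Longrightarrow> (\<Sum>v\<in>V. w u v) = k"
    and col: "\<And>v. v \<in> V \<Longrightarrow> (\<Sum>u\<in>V. w u v) = k"
  obtains \<pi> where "bij_betw \<pi> V V" "\<And>u. u \<in> V \<Longrightarrow> w u (\<pi> u) > 0"
proof -
  define F where "F = (\<lambda>u. {v \<in> V. w u v > 0})"
  have "card J \<le> card (\<Union>j\<in>J. F j)" if J: "J \<subseteq> V" for J
  proof -
    let ?N = "\<Union>j\<in>J. F j"
    have N: "?N \<subseteq> V" by (auto simp: F_def)
    have "k * card J = (\<Sum>u\<in>J. \<Sum>v\<in>V. w u v)"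
      using row J by (simp add: subset_iff)
    also have "\<dots> = (\<Sum>u\<in>J. \<Sum>v\<in>?N. w u v)"
      by (intro sum.cong refl sum.mono_neutral_right fin N) (auto simp: F_def)
    also have "\<dots> = (\<Sum>v\<in>?N. \<Sum>u\<in>J. w u v)" by (rule sum.swap)
    also have "\<dots> \<le> (\<Sum>v\<in>?N. \<Sum>u\<in>V. w u v)"
      by (rule sum_mono, rule sum_mono2[OF fin J]) simp
    also have "\<dots> = k * card ?N"
      using col N by (simp add: subset_iff)
    finally show ?thesis using \<open>k > 0\<close> by simp
  qed
  from Hall_marriage[OF fin _ this] obtain \<pi>
    where \<pi>: "inj_on \<pi> V" "\<forall>u\<in>V. \<pi> u \<in> F u"
    using fin by (auto simp: F_def)
  then have "\<pi> ` V = V"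
    using fin by (intro endo_inj_surj) (auto simp: F_def)
  with \<pi> show thesis by (intro that[of \<pi>]) (auto simp: bij_betw_def F_def)
qed

text \<open>Both maps are permutations of \<open>Z \<union> W\<close> taken from the support of a
  regular matrix. Removing the first from a \<open>k\<close>-regular matrix leaves a
  \<open>(k - 1)\<close>-regular one, which contains a second because
  \<open>k \<ge> 2\<close>.\<close>

lemma two_disjoint_matchings:
  fixes T :: "'a \<Rightarrow> 'a set"
  assumes fin: "finite Z" "finite W" and disj: "Z \<inter> W = {}" and k: "k \<ge> 2"
    and TW: "\<And>y. y \<in> Z \<Longrightarrow> T y \<subseteq> W"
    and degZ: "\<And>y. y \<in> Z \<Longrightarrow> card (T y) \<le> k"
    and degW: "\<And>x. x \<in> W \<Longrightarrow> card {y \<in> Z. x \<in> T y} \<le> k"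
  defines "W' \<equiv> {x \<in> W. card {y \<in> Z. x \<in> T y} = k}"
  obtains a b where "inj_on a W'" "inj_on b W'"
    "\<And>x. x \<in> W' \<Longrightarrow> a x \<in> Z \<and> b x \<in> Z \<and> x \<in> T (a x) \<and> x \<in> T (b x) \<and> a x \<noteq> b x"
proof -
  define V where "V = Z \<union> W"
  define adj where "adj = (\<lambda>u v. u \<in> Z \<and> v \<in> T u \<or> v \<in> Z \<and> u \<in> T v)"
  define deg where "deg = (\<lambda>u. card {v \<in> V. adj u v})"
  text \<open>Adding \<open>k - deg u\<close> loops at every vertex makes the adjacency matrix \<open>k\<close>-regular, while
    vertices of degree \<open>k\<close> get no loop.\<close>
  define w :: "'a \<Rightarrow> 'a \<Rightarrow> nat"
    where "w = (\<lambda>u v. of_bool (adj u v) + (if u = v then k - deg u else 0))"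
  have finV: "finite V" using fin by (simp add: V_def)
  have adjW: "{v \<in> V. adj x v} = {y \<in> Z. x \<in> T y}" if "x \<in> W" for x
    using that disj TW by (auto simp: adj_def V_def)
  have adjZ: "{v \<in> V. adj y v} = T y" if "y \<in> Z" for y
    using that disj TW by (auto simp: adj_def V_def)
  have deg: "deg u \<le> k" if "u \<in> V" for u
  proof (cases "u \<in> Z")
    case True
    then show ?thesis using adjZ degZ by (simp add: deg_def)
  next
    case False
    then show ?thesis using that adjW degW by (simp add: deg_def V_def)
  qed
  have sym: "w u v = w v u" for u v by (auto simp: w_def adj_def)
  have row: "(\<Sum>v\<in>V. w u v) = k" if "u \<in> V" for u
  proof -
    have "(\<Sum>v\<in>V. w u v) = deg u + (k - deg u)"
      using finV that by (simp add: w_def sum.distrib deg_def Int_def)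
    with deg[OF that] show ?thesis by simp
  qed
  have col: "(\<Sum>u\<in>V. w u v) = k" if "v \<in> V" for v
    using row[OF that] by (simp add: sym[of _ v])
  have adjI: "adj x v \<and> v \<in> Z \<and> x \<in> T v" if "x \<in> W'" "w x v > 0" for x v
  proof -
    have "deg x = k" using that adjW by (simp add: W'_def deg_def)
    then have "adj x v" using that by (auto simp: w_def split: if_splits)
    then show ?thesis using that(1) disj by (auto simp: adj_def W'_def)
  qed
  obtain a where a: "bij_betw a V V" "\<And>u. u \<in> V \<Longrightarrow> w u (a u) > 0"
    by (rule regular_matrix_permutation[OF finV _ row col]) (use k in auto)
  define w' where "w' = (\<lambda>u v. w u v - of_bool (a u = v))"
  have le: "of_bool (a u = v) \<le> w u v" if "u \<in> V" for u v
    using a(2)[OF that] by (auto simp: Suc_le_eq)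
  have "(\<Sum>v\<in>V. w' u v) = k - 1" if "u \<in> V" for u
  proof -
    have "V \<inter> {v. a u = v} = {a u}" using a(1) that by (auto simp: bij_betw_def)
    moreover have "(\<Sum>v\<in>V. w' u v) = (\<Sum>v\<in>V. w u v) - (\<Sum>v\<in>V. of_bool (a u = v))"
      unfolding w'_def by (rule sum_subtractf_nat) (rule le[OF that])
    ultimately show ?thesis using row[OF that] finV by simp
  qed
  moreover have "(\<Sum>u\<in>V. w' u v) = k - 1" if v: "v \<in> V" for v
  proof -
    have "v \<in> a ` V" using a(1) v by (simp add: bij_betw_def)
    then obtain u where "u \<in> V" "a u = v" by blast
    then have "V \<inter> {u. a u = v} = {u}"
      using a(1) by (auto simp: bij_betw_def inj_on_def)
    moreover have "(\<Sum>u\<in>V. w' u v) = (\<Sum>u\<in>V. w u v) - (\<Sum>u\<in>V. of_bool (a u = v))"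
      unfolding w'_def by (rule sum_subtractf_nat) (rule le)
    ultimately show ?thesis using col[OF v] finV by simp
  qed
  ultimately obtain b where b: "bij_betw b V V" "\<And>u. u \<in> V \<Longrightarrow> w' u (b u) > 0"
    using regular_matrix_permutation[OF finV, of "k - 1" w'] k by auto
  have W'V: "W' \<subseteq> V" by (auto simp: W'_def V_def)
  have bneq: "a x \<noteq> b x" if "x \<in> W'" for x
  proof
    assume eq: "a x = b x"
    have x: "x \<in> V" using W'V that by blast
    have adj: "adj x (a x)" "a x \<in> Z" using adjI[OF that a(2)[OF x]] by auto
    \<comment> \<open>An edge between different vertices has weight one, so the first matching uses
      it up and \<open>w'\<close> vanishes there.\<close>
    then have "x \<noteq> a x" using that disj by (auto simp: W'_def)
    then have "w x (a x) \<le> 1" by (simp add: w_def)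
    with b(2)[OF x] eq show False by (simp add: w'_def)
  qed
  have bpos: "w x (b x) > 0" if "x \<in> V" for x
    using b(2)[OF that] by (simp add: w'_def)
  show thesis
  proof (rule that[of a b])
    show "inj_on a W'" "inj_on b W'"
      using a(1) b(1) W'V by (auto simp: bij_betw_def intro: inj_on_subset)
    show "a x \<in> Z \<and> b x \<in> Z \<and> x \<in> T (a x) \<and> x \<in> T (b x) \<and> a x \<noteq> b x" if "x \<in> W'" for x
      using adjI[OF that] a(2) bpos bneq[OF that] W'V that by blast
  qed
qed

text \<open>The images of \<open>a\<close> and \<open>b\<close> are equally large, hence so are
  their complements in the finite set \<open>Z\<close>. Any bijection \<open>g\<close> between the
  complements completes the partial map sending \<open>a x\<close> to \<open>b x\<close>.\<close>

lemma permutes_extending: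
  assumes fin: "finite Z" and a: "inj_on a W" "a ` W \<subseteq> Z" and b: "inj_on b W" "b ` W \<subseteq> Z"
  obtains \<sigma> where "\<sigma> permutes Z" "\<And>x. x \<in> W \<Longrightarrow> \<sigma> (a x) = b x"
proof -
  have "card (Z - a ` W) = card (Z - b ` W)"
    using a b fin by (simp add: card_Diff_subset finite_subset card_image)
  then obtain g where g: "bij_betw g (Z - a ` W) (Z - b ` W)"
    using fin by (metis finite_Diff finite_same_card_bij)
  have f: "bij_betw (b \<circ> inv_into W a) (a ` W) (b ` W)"
    using a(1) b(1) by (intro bij_betw_trans[of _ _ W]) (auto simp: inj_on_imp_bij_betw bij_betw_inv_into)
  define \<sigma> where "\<sigma> = (\<lambda>y. if y \<in> Z then (if y \<in> a ` W then (b \<circ> inv_into W a) y else g y) else y)"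
  have "bij_betw \<sigma> (a ` W \<union> (Z - a ` W)) (b ` W \<union> (Z - b ` W))"
  proof (rule bij_betw_combine)
    show "bij_betw \<sigma> (a ` W) (b ` W)"
      using f a(2) by (subst bij_betw_cong[of _ _ "b \<circ> inv_into W a"]) (auto simp: \<sigma>_def)
    show "bij_betw \<sigma> (Z - a ` W) (Z - b ` W)"
      using g by (subst bij_betw_cong[of _ _ g]) (auto simp: \<sigma>_def)
  qed auto
  then have "\<sigma> permutes Z"
    using a(2) b(2) by (intro bij_imp_permutes) (auto simp: \<sigma>_def Un_absorb1)
  moreover have "\<sigma> (a x) = b x" if "x \<in> W" for x
    using that a by (auto simp: \<sigma>_def)
  ultimately show thesis by (rule that)
qed

text \<open>Vertices are coloured one after another: each new one has fewer than \<open>m\<close>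
  neighbours, so one of the \<open>m\<close> colours is free. The degree bound passes to subsets of
  \<open>I\<close>, which lets the induction run.\<close>

lemma greedy_colouring:
  assumes "finite I" and sym: "\<And>i j. R i j \<Longrightarrow> R j i"
    and "\<And>i. i \<in> I \<Longrightarrow> card {j \<in> I. j \<noteq> i \<and> R i j} < m"
  obtains c :: "'i \<Rightarrow> nat" where "c ` I \<subseteq> {..<m}"
    "\<And>i j. i \<in> I \<Longrightarrow> j \<in> I \<Longrightarrow> i \<noteq> j \<Longrightarrow> R i j \<Longrightarrow> c i \<noteq> c j"
proof -
  have "\<exists>c::'i \<Rightarrow> nat. c ` I \<subseteq> {..<m} \<and> (\<forall>i\<in>I. \<forall>j\<in>I. i \<noteq> j \<longrightarrow> R i j \<longrightarrow> c i \<noteq> c j)"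
    using assms(1,3)
  proof (induction I)
    case (insert a I)
    have "card {j \<in> I. j \<noteq> i \<and> R i j} < m" if "i \<in> I" for i
      by (rule le_less_trans[OF card_mono insert.prems[of i]]) (use insert.hyps that in auto)
    then have "\<exists>c::'i \<Rightarrow> nat. c ` I \<subseteq> {..<m} \<and> (\<forall>i\<in>I. \<forall>j\<in>I. i \<noteq> j \<longrightarrow> R i j \<longrightarrow> c i \<noteq> c j)"
      by (rule insert.IH)
    then obtain c :: "'i \<Rightarrow> nat" where
      c: "c ` I \<subseteq> {..<m} \<and> (\<forall>i\<in>I. \<forall>j\<in>I. i \<noteq> j \<longrightarrow> R i j \<longrightarrow> c i \<noteq> c j)" ..
    let ?N = "{j \<in> insert a I. j \<noteq> a \<and> R a j}"
    have "card (c ` ?N) < m"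
      using insert.prems[of a] insert.hyps(1) card_image_le[of ?N c] by auto
    then have "\<not> {..<m} \<subseteq> c ` ?N"
      using card_mono[of "c ` ?N" "{..<m}"] insert.hyps(1) by auto
    then obtain n where n: "n < m" "n \<notin> c ` ?N" by auto
    have "(c(a := n)) ` insert a I \<subseteq> {..<m}" using c n(1) by auto
    moreover have "(c(a := n)) i \<noteq> (c(a := n)) j"
      if "i \<in> insert a I" "j \<in> insert a I" "i \<noteq> j" "R i j" for i j
      using that c n(2) sym[of i j] by auto
    ultimately show ?case by blast
  qed auto
  then obtain c :: "'i \<Rightarrow> nat" where
    "c ` I \<subseteq> {..<m} \<and> (\<forall>i\<in>I. \<forall>j\<in>I. i \<noteq> j \<longrightarrow> R i j \<longrightarrow> c i \<noteq> c j)" ..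
  then show thesis by (intro that[of c]) auto
qed

text \<open>Only vertices of full degree \<open>k\<close> could meet too many blocks. Two of their
  neighbours are made consecutive under \<open>\<sigma>\<close>, so that these share most of their
  blocks.\<close>

lemma cyclic_order_of_neighbours:
  fixes T :: "'a \<Rightarrow> 'a set"
  assumes fin: "finite Z" "finite W" and disj: "Z \<inter> W = {}" and k: "k \<ge> 2"
    and TW: "\<And>y. y \<in> Z \<Longrightarrow> T y \<subseteq> W"
    and degZ: "\<And>y. y \<in> Z \<Longrightarrow> card (T y) \<le> k"
    and degW: "\<And>x. x \<in> W \<Longrightarrow> card {y \<in> Z. x \<in> T y} \<le> k"
  obtains \<sigma> where "\<sigma> permutes Z"
    "\<And>x. x \<in> W \<Longrightarrow> card {y \<in> Z. x \<in> T y} = k \<Longrightarrow> \<exists>y\<in>Z. \<sigma> y \<noteq> y \<and> x \<in> T y \<and> x \<in> T (\<sigma> y)"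
proof -
  let ?W' = "{x \<in> W. card {y \<in> Z. x \<in> T y} = k}"
  obtain a b where ab: "inj_on a ?W'" "inj_on b ?W'"
    "\<And>x. x \<in> ?W' \<Longrightarrow> a x \<in> Z \<and> b x \<in> Z \<and> x \<in> T (a x) \<and> x \<in> T (b x) \<and> a x \<noteq> b x"
    using two_disjoint_matchings[OF assms] by blast
  have im: "a ` ?W' \<subseteq> Z" "b ` ?W' \<subseteq> Z" using ab(3) by auto
  obtain \<sigma> where \<sigma>: "\<sigma> permutes Z" "\<And>x. x \<in> ?W' \<Longrightarrow> \<sigma> (a x) = b x"
    by (rule permutes_extending[OF fin(1) ab(1) im(1) ab(2) im(2)]) blast
  have "\<exists>y\<in>Z. \<sigma> y \<noteq> y \<and> x \<in> T y \<and> x \<in> T (\<sigma> y)" if "x \<in> W" "card {y \<in> Z. x \<in> T y} = k" for x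
    using ab(3)[of x] \<sigma>(2)[of x] that by (intro bexI[of _ "a x"]) auto
  with \<sigma>(1) show thesis by (rule that)
qed

section \<open>Blocks along a permutation\<close>

text \<open>In a cycle of at least \<open>h\<close> elements, the blocks through \<open>y\<close>
  start at \<open>y\<close> and its \<open>h - 1\<close> predecessors; for \<open>\<sigma> y\<close>
  only the start \<open>\<sigma> y\<close> is new. In a shorter cycle \<open>y\<close> and
  \<open>\<sigma> y\<close> lie in the same blocks.\<close>

lemma cyclic_blocks:
  fixes \<sigma> :: "'a \<Rightarrow> 'a"
  assumes fin: "finite Z" and perm: "\<sigma> permutes Z" and h: "h \<ge> 1"
  obtains I :: "('a \<times> nat) set" and B where "finite I"
    "\<And>i. B i \<subseteq> Z" "\<And>i. card (B i) \<le> h"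
    "\<And>y. y \<in> Z \<Longrightarrow> card {i \<in> I. y \<in> B i} = h"
    "\<And>y. y \<in> Z \<Longrightarrow> card {i \<in> I. y \<in> B i \<or> \<sigma> y \<in> B i} \<le> h + 1"
proof -
  text \<open>A start \<open>s\<close> is \<open>short\<close> if its cycle has fewer than \<open>h\<close> elements; then \<open>seg s\<close> is the whole cycle,
    which is used \<open>h\<close> times, tagged \<open>j < h\<close> and started at a fixed representative. In a longer cycle
    every element starts one block.\<close>
  define short where "short = (\<lambda>s. \<exists>d. 0 < d \<and> d < h \<and> (\<sigma> ^^ d) s = s)"
  define seg where "seg = (\<lambda>s. (\<lambda>i. (\<sigma> ^^ i) s) ` {..<h})"
  define rep where "rep = (\<lambda>s. SOME t. t \<in> seg s)"
  define I where "I = {(s, j). s \<in> Z \<and> (if short s then s = rep s \<and> j < h else j = 0)}"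
  define B where "B = (\<lambda>(s, j :: nat). if s \<in> Z then seg s else {})"
  define \<tau> where "\<tau> = inv \<sigma>"
  have inv: "\<sigma> (\<tau> y) = y" "\<tau> (\<sigma> y) = y" for y
    using permutes_inverses[OF perm] by (auto simp: \<tau>_def)
  have \<sigma>_inj: "\<sigma> u = \<sigma> v \<longleftrightarrow> u = v" for u v using inv(2) by metis
  have funpow_inv: "(\<tau> ^^ n) y = s \<longleftrightarrow> (\<sigma> ^^ n) s = y" for n y s
  proof (induction n arbitrary: s)
    case (Suc n)
    have "(\<tau> ^^ Suc n) y = s \<longleftrightarrow> (\<tau> ^^ n) y = \<sigma> s" using inv by auto
    with Suc[of "\<sigma> s"] show ?case by (simp add: funpow_swap1)
  qed auto
  have funpow_Z: "(\<sigma> ^^ n) s \<in> Z \<longleftrightarrow> s \<in> Z" for n s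
    by (induction n) (auto simp: permutes_in_image[OF perm])
  have self: "s \<in> seg s" for s
    using h unfolding seg_def by (intro image_eqI[of _ _ 0]) auto
  have seg_Z: "seg s \<subseteq> Z" if "s \<in> Z" for s
    using that by (auto simp: seg_def funpow_Z)
  have short_step: "short (\<sigma> s) \<longleftrightarrow> short s" for s
    by (simp add: short_def funpow_swap1[symmetric] \<sigma>_inj)
  have short_funpow: "short ((\<sigma> ^^ n) s) \<longleftrightarrow> short s" for n s
    by (induction n) (auto simp: short_step)
  have short_seg: "short t \<longleftrightarrow> short s" if "t \<in> seg s" for s t
    using that by (auto simp: seg_def short_funpow)
  have seg_all: "(\<sigma> ^^ n) s \<in> seg s" if s: "short s" for n s
  proof -
    obtain d where d: "0 < d" "d < h" "(\<sigma> ^^ d) s = s" using s unfolding short_def by blast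
    then have "(\<sigma> ^^ n) s = (\<sigma> ^^ (n mod d)) s" by (simp add: funpow_mod_eq)
    moreover have "n mod d < h" using d by (meson less_trans mod_less_divisor)
    ultimately show ?thesis by (auto simp: seg_def)
  qed
  have seg_step: "seg (\<sigma> s) = seg s" if s: "short s" for s
  proof
    show "seg (\<sigma> s) \<subseteq> seg s"
    proof
      fix t assume "t \<in> seg (\<sigma> s)"
      then obtain i where "t = (\<sigma> ^^ Suc i) s" by (auto simp: seg_def funpow_swap1)
      then show "t \<in> seg s" using seg_all[OF s, of "Suc i"] by simp
    qed
    obtain d where d: "0 < d" "(\<sigma> ^^ d) s = s" using s by (auto simp: short_def)
    have "(\<sigma> ^^ i) s \<in> seg (\<sigma> s)" for i
    proof -
      \<comment> \<open>One step is already taken in \<open>\<sigma> s\<close>, so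
        \<open>d - 1\<close> more lead back to \<open>s\<close>.\<close>
      have "(\<sigma> ^^ (i + (d - 1))) (\<sigma> s) = (\<sigma> ^^ (i + d)) s"
        using d(1) by (cases d) (auto simp: funpow_swap1)
      also have "\<dots> = (\<sigma> ^^ i) s" using d(2) by (simp add: funpow_add)
      finally show ?thesis using seg_all[where s = "\<sigma> s" and n = "i + (d - 1)"] s short_step by simp
    qed
    moreover have "\<exists>i. t = (\<sigma> ^^ i) s" if "t \<in> seg s" for t using that by (auto simp: seg_def)
    ultimately show "seg s \<subseteq> seg (\<sigma> s)" by blast
  qed
  have seg_funpow: "seg ((\<sigma> ^^ n) s) = seg s" if "short s" for n s
    using that by (induction n) (auto simp: seg_step short_funpow)
  have seg_eq: "seg t = seg s" if "short s" "t \<in> seg s" for s t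
  proof -
    have "\<exists>n. t = (\<sigma> ^^ n) s" using that(2) by (auto simp: seg_def)
    then show ?thesis using seg_funpow[OF that(1)] by auto
  qed
  have rep: "rep s \<in> seg s" for s
    unfolding rep_def using self by (rule someI)
  have short_blocks: "{i \<in> I. y \<in> B i} = {rep y} \<times> {..<h}" if y: "y \<in> Z" "short y" for y
  proof -
    have sub: "(s, j) \<in> {rep y} \<times> {..<h}" if "(s, j) \<in> I" "y \<in> B (s, j)" for s j
    proof -
      have ys: "y \<in> seg s" using that by (auto simp: I_def B_def)
      then have s: "short s" using y short_seg by blast
      then have "seg y = seg s" using ys seg_eq by blast
      \<comment> \<open>\<open>rep\<close> chooses from the set \<open>seg s\<close> without looking
        at \<open>s\<close> itself, so all elements of a short cycle get the same
        representative.\<close>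
      then have "rep y = rep s" by (simp add: rep_def)
      then show ?thesis using s that(1) by (auto simp: I_def)
    qed
    have r: "rep y \<in> Z" "short (rep y)" "seg (rep y) = seg y"
      using seg_Z[OF y(1)] rep[of y] short_seg y(2) seg_eq by blast+
    then have "rep (rep y) = rep y" by (simp add: rep_def)
    then have "{rep y} \<times> {..<h} \<subseteq> {i \<in> I. y \<in> B i}"
      using r self[of y] by (auto simp: I_def B_def)
    with sub show ?thesis by fast
  qed
  have long_blocks: "{i \<in> I. y \<in> B i} = (\<lambda>i. ((\<tau> ^^ i) y, 0)) ` {..<h}"
    if y: "y \<in> Z" "\<not> short y" for y
  proof (intro set_eqI iffI)
    fix z assume z: "z \<in> {i \<in> I. y \<in> B i}"
    then obtain s j where sj: "z = (s, j)" "(s, j) \<in> I" "y \<in> seg s"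
      by (cases z) (auto simp: I_def B_def)
    then have "j = 0" using short_seg[of y s] y by (auto simp: I_def)
    moreover obtain i where "i < h" "y = (\<sigma> ^^ i) s" using sj(3) by (auto simp: seg_def)
    moreover from this have "(\<tau> ^^ i) y = s" using funpow_inv by metis
    ultimately show "z \<in> (\<lambda>i. ((\<tau> ^^ i) y, 0)) ` {..<h}"
      using sj(1) by (intro image_eqI[of _ _ i]) auto
  next
    fix z assume "z \<in> (\<lambda>i. ((\<tau> ^^ i) y, 0 :: nat)) ` {..<h}"
    then obtain i s where i: "i < h" "z = (s, 0)" "(\<tau> ^^ i) y = s" by auto
    then have y': "y = (\<sigma> ^^ i) s" using funpow_inv by metis
    then have "y \<in> seg s" "s \<in> Z" "\<not> short s"
      using i(1) y funpow_Z short_funpow by (auto simp: seg_def)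
    then show "z \<in> {i \<in> I. y \<in> B i}" using i by (auto simp: I_def B_def)
  qed
  \<comment> \<open>A coincidence would give \<open>y\<close> the period \<open>j - i\<close>, which
    is positive and below \<open>h\<close>, and so make \<open>y\<close> short.\<close>
  have tau_neq: "(\<tau> ^^ i) y \<noteq> (\<tau> ^^ j) y" if "\<not> short y" "i < j" "j < h" for y i j
  proof
    assume eq: "(\<tau> ^^ i) y = (\<tau> ^^ j) y"
    define s where "s = (\<tau> ^^ i) y"
    have "y = (\<sigma> ^^ i) s" "y = (\<sigma> ^^ j) s" using funpow_inv s_def eq by metis+
    moreover have "(\<sigma> ^^ j) s = (\<sigma> ^^ (j - i)) ((\<sigma> ^^ i) s)"
      using that(2) by (simp flip: funpow_add[unfolded comp_def, THEN fun_cong])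
    ultimately have "(\<sigma> ^^ (j - i)) y = y" by simp
    then have "short y" unfolding short_def using that by (intro exI[of _ "j - i"]) auto
    with that show False by simp
  qed
  have card_blocks: "card {i \<in> I. y \<in> B i} = h" if y: "y \<in> Z" for y
  proof (cases "short y")
    case True
    then show ?thesis using y by (simp add: short_blocks card_cartesian_product)
  next
    case False
    have "inj_on (\<lambda>i. ((\<tau> ^^ i) y, 0 :: nat)) {..<h}"
      using tau_neq[OF False] by (intro linorder_inj_onI) auto
    then show ?thesis using False y by (simp add: long_blocks card_image)
  qed
  have "card {i \<in> I. y \<in> B i \<or> \<sigma> y \<in> B i} \<le> h + 1" if y: "y \<in> Z" for y
  proof -
    have Sy: "\<sigma> y \<in> Z" using y permutes_in_image[OF perm] by simp
    have split: "{i \<in> I. y \<in> B i \<or> \<sigma> y \<in> B i} = {i \<in> I. y \<in> B i} \<union> {i \<in> I. \<sigma> y \<in> B i}" by auto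
    show ?thesis
    proof (cases "short y")
      case True
      have "rep (\<sigma> y) = rep y" using True by (simp add: rep_def seg_step)
      then have "{i \<in> I. \<sigma> y \<in> B i} = {i \<in> I. y \<in> B i}"
        using True y Sy by (simp add: short_blocks short_step)
      then show ?thesis using split card_blocks[OF y] by simp
    next
      case False
      have "{i \<in> I. \<sigma> y \<in> B i} \<subseteq> insert (\<sigma> y, 0) {i \<in> I. y \<in> B i}"
      proof
        fix z assume "z \<in> {i \<in> I. \<sigma> y \<in> B i}"
        then obtain i where i: "i < h" "z = ((\<tau> ^^ i) (\<sigma> y), 0)"
          using False y Sy by (auto simp: long_blocks short_step)
        show "z \<in> insert (\<sigma> y, 0) {i \<in> I. y \<in> B i}"
        proof (cases i)
          case 0
          then show ?thesis using i by simp
        next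
          case (Suc i')
          then have "z = ((\<tau> ^^ i') y, 0)" using i by (simp add: funpow_swap1 inv)
          then show ?thesis using False y i Suc by (auto simp: long_blocks)
        qed
      qed
      then have "{i \<in> I. y \<in> B i \<or> \<sigma> y \<in> B i} \<subseteq> insert (\<sigma> y, 0) {i \<in> I. y \<in> B i}" by auto
      moreover have fin_y: "finite {i \<in> I. y \<in> B i}"
        using card_blocks[OF y] h by (intro card_ge_0_finite) simp
      ultimately have "card {i \<in> I. y \<in> B i \<or> \<sigma> y \<in> B i} \<le> card (insert (\<sigma> y, 0) {i \<in> I. y \<in> B i})"
        by (intro card_mono) auto
      also have "\<dots> \<le> h + 1"
        using card_blocks[OF y] by (simp add: card_insert_if[OF fin_y])
      finally show ?thesis .
    qed
  qed
  moreover have "finite I"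
    by (rule finite_subset[of _ "Z \<times> {..<h}"]) (use fin h in \<open>auto simp: I_def split: if_splits\<close>)
  moreover have "card (B i) \<le> h" for i
    using card_image_le[of "{..<h}"] by (auto simp: B_def seg_def split: prod.split)
  moreover have "B i \<subseteq> Z" for i
    using seg_Z by (auto simp: B_def split: prod.split)
  ultimately show thesis using card_blocks that[of I B] by blast
qed

lemma card_Collect_bex_le:
  assumes "finite A" and "\<And>y. y \<in> A \<Longrightarrow> card {i \<in> I. P i y} \<le> h"
  shows "card {i \<in> I. \<exists>y\<in>A. P i y} \<le> card A * h"
proof -
  have eq: "{i \<in> I. \<exists>y\<in>A. P i y} = (\<Union>y\<in>A. {i \<in> I. P i y})" by auto
  have "card {i \<in> I. \<exists>y\<in>A. P i y} \<le> (\<Sum>y\<in>A. card {i \<in> I. P i y})"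
    unfolding eq by (rule card_UN_le[OF assms(1)])
  also have "\<dots> \<le> card A * h" using sum_bounded_above[of A "\<lambda>y. card {i \<in> I. P i y}" h] assms(2) by simp
  finally show ?thesis .
qed

section \<open>Counting the blocks that meet a neighbourhood\<close>

text \<open>Up to \<open>k - 1\<close> neighbours meet at most \<open>(k - 1) * h\<close> blocks.
  With \<open>k \<ge> 2\<close> neighbours, two consecutive ones meet at most \<open>h + 1\<close>
  blocks and the other \<open>k - 2\<close> at most \<open>h\<close> each. For \<open>k = 1\<close>
  there is no second neighbour, but then \<open>h = 1\<close> and a single block is met.\<close>

lemma exchange_blocks:
  fixes T :: "'a \<Rightarrow> 'a set"
  assumes fin: "finite Z" "finite W" and disj: "Z \<inter> W = {}"
    and k: "k \<ge> 1" and h: "h \<ge> 1" and kh: "k = 1 \<longrightarrow> h = 1"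
    and TW: "\<And>y. y \<in> Z \<Longrightarrow> T y \<subseteq> W"
    and degZ: "\<And>y. y \<in> Z \<Longrightarrow> card (T y) \<le> k"
    and degW: "\<And>x. x \<in> W \<Longrightarrow> card {y \<in> Z. x \<in> T y} \<le> k"
  obtains I :: "('a \<times> nat) set" and B where "finite I"
    "\<And>i. B i \<subseteq> Z" "\<And>i. card (B i) \<le> h"
    "\<And>y. y \<in> Z \<Longrightarrow> card {i \<in> I. y \<in> B i} = h"
    "\<And>x. x \<in> W \<Longrightarrow> card {i \<in> I. \<exists>y\<in>B i. x \<in> T y} \<le> (k - 1) * h + 1"
proof -
  obtain \<sigma> where \<sigma>: "\<sigma> permutes Z"
    "\<And>x. x \<in> W \<Longrightarrow> k \<ge> 2 \<Longrightarrow> card {y \<in> Z. x \<in> T y} = k \<Longrightarrow>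
      \<exists>y\<in>Z. \<sigma> y \<noteq> y \<and> x \<in> T y \<and> x \<in> T (\<sigma> y)"
  proof (cases "k \<ge> 2")
    case True
    obtain \<sigma> where "\<sigma> permutes Z"
      "\<And>x. x \<in> W \<Longrightarrow> card {y \<in> Z. x \<in> T y} = k \<Longrightarrow> \<exists>y\<in>Z. \<sigma> y \<noteq> y \<and> x \<in> T y \<and> x \<in> T (\<sigma> y)"
      by (rule cyclic_order_of_neighbours[OF fin disj True TW degZ degW]) blast+
    then show thesis by (intro that[of \<sigma>]) blast+
  next
    case False
    \<comment> \<open>For \<open>k = 1\<close> nothing is asked of \<open>\<sigma>\<close> beyond
      being a permutation.\<close>
    then show thesis using that[OF permutes_id] by blast
  qed
  obtain I :: "('a \<times> nat) set" and B where IB: "finite I"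
    "\<And>i. B i \<subseteq> Z" "\<And>i. card (B i) \<le> h"
    "\<And>y. y \<in> Z \<Longrightarrow> card {i \<in> I. y \<in> B i} = h"
    "\<And>y. y \<in> Z \<Longrightarrow> card {i \<in> I. y \<in> B i \<or> \<sigma> y \<in> B i} \<le> h + 1"
    by (rule cyclic_blocks[OF fin(1) \<sigma>(1) h]) blast
  have "card {i \<in> I. \<exists>y\<in>B i. x \<in> T y} \<le> (k - 1) * h + 1" if x: "x \<in> W" for x
  proof -
    let ?N = "{y \<in> Z. x \<in> T y}"
    have hit: "card {i \<in> I. \<exists>y\<in>A. y \<in> B i} \<le> card A * h" if "A \<subseteq> Z" for A
      using that finite_subset[OF that fin(1)] IB(4) by (intro card_Collect_bex_le) auto
    have eq: "{i \<in> I. \<exists>y\<in>B i. x \<in> T y} = {i \<in> I. \<exists>y\<in>?N. y \<in> B i}" using IB(2) by blast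
    show ?thesis
    proof (cases "card ?N = k \<and> k \<ge> 2")
      case True
      then obtain y where y: "y \<in> Z" "\<sigma> y \<noteq> y" "x \<in> T y" "x \<in> T (\<sigma> y)" using \<sigma>(2) x by blast
      have \<sigma>y: "\<sigma> y \<in> Z" using y(1) permutes_in_image[OF \<sigma>(1)] by simp
      let ?A = "?N - {y, \<sigma> y}"
      have "card ?A = k - 2"
        using True y \<sigma>y fin(1) by (subst card_Diff_subset) auto
      moreover have "{i \<in> I. \<exists>y\<in>?N. y \<in> B i} =
        {i \<in> I. \<exists>y\<in>?A. y \<in> B i} \<union> {i \<in> I. y \<in> B i \<or> \<sigma> y \<in> B i}"
        using y \<sigma>y by auto
      ultimately have "card {i \<in> I. \<exists>y\<in>?N. y \<in> B i} \<le> (k - 2) * h + (h + 1)"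
        using hit[of ?A] IB(5)[OF y(1)] card_Un_le[of "{i \<in> I. \<exists>y\<in>?A. y \<in> B i}" "{i \<in> I. y \<in> B i \<or> \<sigma> y \<in> B i}"]
        by fastforce
      also have "\<dots> = (k - 1) * h + 1"
        using True by (auto simp: le_iff_add)
      finally show ?thesis unfolding eq .
    next
      case False
      then have "card ?N * h \<le> (k - 1) * h + 1"
      proof (cases "card ?N \<le> k - 1")
        case False
        then have "k = 1" using \<open>\<not> (card ?N = k \<and> k \<ge> 2)\<close> degW[OF x] k by linarith
        then show ?thesis using kh degW[OF x] by simp
      next
        case True
        then show ?thesis using mult_le_mono1[OF True, of h] by linarith
      qed
      then show ?thesis unfolding eq using hit[of ?N] by fastforce
    qed
  qed
  with IB(1-4) show thesis by (rule that)
qed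

section \<open>Random choice of blocks\<close>

text \<open>Intersecting with the supports makes both factors countable without changing any
  probability.\<close>

lemma prob_pair_pmf_Times:
  "measure_pmf.prob (pair_pmf M N) (A \<times> B) = measure_pmf.prob M A * measure_pmf.prob N B"
proof -
  have "measure_pmf.prob (pair_pmf M N) (A \<times> B)
      = measure_pmf.prob (pair_pmf M N) ((A \<inter> set_pmf M) \<times> (B \<inter> set_pmf N))"
    by (subst measure_Int_set_pmf[symmetric]) (simp add: Times_Int_Times)
  also have "\<dots> = measure_pmf.prob M A * measure_pmf.prob N B"
    by (subst measure_pmf_prob_product) (auto simp: measure_Int_set_pmf)
  finally show ?thesis .
qed

lemma prob_subset_random_subset_pmf:
  assumes "finite A" "B \<subseteq> A" "0 \<le> p" "p \<le> 1"
  shows "measure_pmf.prob (random_subset_pmf p A) {R. B \<subseteq> R} = p ^ card B"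
proof -
  \<comment> \<open>The event constrains only the coordinates in \<open>B\<close>, so it is a
    product set.\<close>
  have "measure_pmf.prob (random_subset_pmf p A) {R. B \<subseteq> R}
      = measure_pmf.prob (Pi_pmf A False (\<lambda>_. bernoulli_pmf p)) (Pi A (\<lambda>a. if a \<in> B then {True} else UNIV))"
    unfolding random_subset_pmf_def measure_map_pmf
    using assms(2) by (intro arg_cong2[of _ _ _ _ measure]) (auto simp: Pi_def)
  also have "\<dots> = (\<Prod>a\<in>A. if a \<in> B then p else 1)"
    using assms by (subst measure_Pi_pmf_Pi) (auto intro!: prod.cong simp: measure_pmf_single)
  also have "\<dots> = p ^ card B"
    using assms(1,2) by (simp add: prod.If_cases Int_absorb1)
  finally show ?thesis .
qed

text \<open>Each block is used with probability \<open>p ^ h / h\<^sup>2\<close>. The events of the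
  \<open>h\<close> blocks through \<open>y\<close> are disjoint, so their probabilities add up to
  \<open>p ^ h / h\<close>; for the at most \<open>m\<close> blocks that remove \<open>x\<close> the
  union bound suffices.\<close>

lemma exchange_map_of_blocks:
  fixes B :: "'i \<Rightarrow> 'a set" and T :: "'a \<Rightarrow> 'a set" and p :: real and h m :: nat
  assumes finZ: "finite (Y - X)" and p: "0 < p" "p < 1" and h: "h \<ge> 1" and I: "finite I"
    and BZ: "\<And>i. B i \<subseteq> Y - X" and cardB: "\<And>i. card (B i) \<le> h"
    and cover: "\<And>y. y \<in> Y - X \<Longrightarrow> card {i \<in> I. y \<in> B i} = h"
    and TW: "\<And>y. y \<in> Y - X \<Longrightarrow> T y \<subseteq> X - Y"
    and ex: "\<And>S. S \<subseteq> Y - X \<Longrightarrow> (X \<union> S) - (\<Union>y\<in>S. T y) \<in> D"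
    and hit: "\<And>x. x \<in> X - Y \<Longrightarrow> card {i \<in> I. \<exists>y\<in>B i. x \<in> T y} \<le> m"
  shows "\<exists>M. random_exchange_map D X Y M \<and>
    uniform_exchange_map p (p ^ h / real h) (real m * (p ^ h / (real h)\<^sup>2)) X Y M"
proof -
  have finB: "finite (B i)" for i using finite_subset[OF BZ finZ] .
  \<comment> \<open>Each of the at most \<open>h\<close> elements of \<open>B i\<close> lies in
    \<open>h - 1\<close> further blocks, which gives at most \<open>h * (h - 1)\<close>
    conflicts.\<close>
  have conflicts: "card {j \<in> I. j \<noteq> i \<and> B i \<inter> B j \<noteq> {}} < h\<^sup>2" if i: "i \<in> I" for i
  proof -
    have one: "card {j \<in> I. j \<noteq> i \<and> y \<in> B j} = h - 1" if y: "y \<in> B i" for y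
    proof -
      have "{j \<in> I. j \<noteq> i \<and> y \<in> B j} = {j \<in> I. y \<in> B j} - {i}" by auto
      moreover have "card {j \<in> I. y \<in> B j} = h" using cover[of y] y BZ[of i] by blast
      ultimately show ?thesis using y i by simp
    qed
    have eq: "{j \<in> I. j \<noteq> i \<and> B i \<inter> B j \<noteq> {}} = (\<Union>y\<in>B i. {j \<in> I. j \<noteq> i \<and> y \<in> B j})" by auto
    have "card {j \<in> I. j \<noteq> i \<and> B i \<inter> B j \<noteq> {}} \<le> (\<Sum>y\<in>B i. card {j \<in> I. j \<noteq> i \<and> y \<in> B j})"
      unfolding eq by (rule card_UN_le[OF finB])
    also have "\<dots> \<le> h * (h - 1)" using one cardB[of i] by simp
    also have "\<dots> < h\<^sup>2" using h by (simp add: power2_eq_square)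
    finally show ?thesis .
  qed
  obtain c :: "'i \<Rightarrow> nat" where c: "c ` I \<subseteq> {..<h\<^sup>2}"
    "\<And>i j. i \<in> I \<Longrightarrow> j \<in> I \<Longrightarrow> i \<noteq> j \<Longrightarrow> B i \<inter> B j \<noteq> {} \<Longrightarrow> c i \<noteq> c j"
    by (rule greedy_colouring[where R = "\<lambda>i j. B i \<inter> B j \<noteq> {}", OF I _ conflicts]) auto
  text \<open>The coin indexed by \<open>n\<close> compensates for blocks with \<open>n < h\<close> elements, so that every block is
    accepted with probability exactly \<open>p ^ h\<close>.\<close>
  define C where "C = Pi_pmf {..h} False (\<lambda>n. bernoulli_pmf (p ^ (h - n)))"
  define N where "N = pair_pmf (pmf_of_set {..<h\<^sup>2}) C"
  define S where "S = (\<lambda>(j, V) R. \<Union>i\<in>{i \<in> I. c i = j \<and> B i \<subseteq> R \<and> V (card (B i))}. B i)"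
  define f where "f = (\<lambda>n. (S n, \<lambda>R. \<Union>y\<in>S n R. T y))"
  define Q where "Q = random_subset_pmf p (Y - X)"
  \<comment> \<open>The event that block \<open>i\<close> is used: it lies in \<open>R\<close>, its
    colour is drawn and its coin succeeds. As a product set it has the product of the three
    probabilities.\<close>
  define ev where "ev = (\<lambda>i. {R. B i \<subseteq> R} \<times> {c i} \<times> {V. V (card (B i))})"
  have prob_coin: "measure_pmf.prob C {V. V n} = p ^ (h - n)" if "n \<le> h" for n
  proof -
    have "measure_pmf.prob C {V. V n} = measure_pmf.prob (map_pmf (\<lambda>V. V n) C) {True}"
      by (simp add: vimage_def)
    also have "\<dots> = p ^ (h - n)"
      using that p unfolding C_def
      by (subst Pi_pmf_component) (auto simp: measure_pmf_single power_le_one)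
    finally show ?thesis .
  qed
  have prob_ev: "measure_pmf.prob (pair_pmf Q N) (ev i) = p ^ h / (real h)\<^sup>2" if "i \<in> I" for i
  proof -
    have "{..<h\<^sup>2} \<inter> {c i} = {c i}" using c(1) that by auto
    moreover have "{..<h\<^sup>2} \<noteq> {}" using h by (auto simp: lessThan_empty_iff)
    ultimately have "measure_pmf.prob (pmf_of_set {..<h\<^sup>2}) {c i} = 1 / (real h)\<^sup>2"
      by (simp add: measure_pmf_of_set)
    moreover have "p ^ card (B i) * p ^ (h - card (B i)) = p ^ h"
      using cardB[of i] by (simp flip: power_add)
    moreover have "measure_pmf.prob Q {R. B i \<subseteq> R} = p ^ card (B i)"
      unfolding Q_def using p finZ BZ by (intro prob_subset_random_subset_pmf) auto
    ultimately show ?thesis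
      by (simp add: ev_def N_def prob_pair_pmf_Times prob_coin[OF cardB])
  qed
  have S_iff: "y \<in> S n R \<longleftrightarrow> (\<exists>i\<in>{i \<in> I. y \<in> B i}. (R, n) \<in> ev i)" for y n R
    by (cases n) (auto simp: S_def ev_def)
  have S_sub: "S n R \<subseteq> R" for n R by (cases n) (auto simp: S_def)
  have S_Z: "S n R \<subseteq> Y - X" for n R using BZ by (cases n) (fastforce simp: S_def)
  have T_sub: "(\<Union>y\<in>S n R. T y) \<subseteq> X - Y" for n R using TW S_Z by blast
  have prob_map: "measure_pmf.prob (pair_pmf Q (map_pmf f N)) {(R, (S, T)). P R S T}
      = measure_pmf.prob (pair_pmf Q N) {(R, n). P R (fst (f n)) (snd (f n))}" for P
    unfolding pair_map_pmf2 measure_map_pmf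
    by (intro arg_cong2[of _ _ _ _ measure]) (auto simp: case_prod_beta)
  show ?thesis
  proof (intro exI[of _ "map_pmf f N"] conjI)
    show "random_exchange_map D X Y (map_pmf f N)"
      using S_sub ex[OF S_Z] T_sub by (auto simp: random_exchange_map_def is_exchange_map_def f_def)
    have "p ^ h / real h \<le> measure_pmf.prob (pair_pmf Q N) {(R, n). y \<in> S n R}" if y: "y \<in> Y - X" for y
    proof -
      let ?J = "{i \<in> I. y \<in> B i}"
      have "measure_pmf.prob (pair_pmf Q N) (\<Union>i\<in>?J. ev i) = (\<Sum>i\<in>?J. measure_pmf.prob (pair_pmf Q N) (ev i))"
      proof (rule measure_pmf.finite_measure_finite_Union)
        \<comment> \<open>Different blocks in \<open>?J\<close> share \<open>y\<close>, so their
          colours differ, and only one colour is drawn.\<close>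
        show "disjoint_family_on ev ?J"
          using c(2) by (fastforce simp: disjoint_family_on_def ev_def)
      qed (use I in auto)
      also have "\<dots> = h * (p ^ h / (real h)\<^sup>2)" using cover[OF y] by (simp add: prob_ev)
      also have "\<dots> = p ^ h / real h" using h by (simp add: power2_eq_square)
      also have "(\<Union>i\<in>?J. ev i) = {(R, n). y \<in> S n R}" using S_iff by auto
      finally show ?thesis by simp
    qed
    moreover have "measure_pmf.prob (pair_pmf Q N) {(R, n). x \<in> (\<Union>y\<in>S n R. T y)} \<le> real m * (p ^ h / (real h)\<^sup>2)"
      if x: "x \<in> X - Y" for x
    proof -
      let ?J = "{i \<in> I. \<exists>y\<in>B i. x \<in> T y}"
      have "{(R, n). x \<in> (\<Union>y\<in>S n R. T y)} = (\<Union>i\<in>?J. ev i)"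
      proof (rule set_eqI)
        show "z \<in> {(R, n). x \<in> (\<Union>y\<in>S n R. T y)} \<longleftrightarrow> z \<in> (\<Union>i\<in>?J. ev i)" for z
          by (cases z) (simp add: Bex_def S_iff, blast)
      qed
      \<comment> \<open>Blocks in \<open>?J\<close> may be disjoint and have the same colour, so
        their events can overlap and only an upper bound results.\<close>
      then have "measure_pmf.prob (pair_pmf Q N) {(R, n). x \<in> (\<Union>y\<in>S n R. T y)}
          \<le> (\<Sum>i\<in>?J. measure_pmf.prob (pair_pmf Q N) (ev i))"
        using I by (simp add: measure_UNION_le)
      also have "\<dots> = card ?J * (p ^ h / (real h)\<^sup>2)" by (simp add: prob_ev)
      also have "\<dots> \<le> real m * (p ^ h / (real h)\<^sup>2)" using hit[OF x] p by (intro mult_right_mono) auto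
      finally show ?thesis .
    qed
    ultimately show "uniform_exchange_map p (p ^ h / real h) (real m * (p ^ h / (real h)\<^sup>2)) X Y (map_pmf f N)"
      unfolding uniform_exchange_map_def Let_def Q_def[symmetric] prob_map by (simp add: f_def)
  qed
qed

section \<open>Assembling the exchange map\<close>

text \<open>For \<open>k = 1\<close> and \<open>h \<ge> 2\<close> the bounds fail by
  \<open>one_exchange_counterexample\<close>; the assumption
  \<open>k = 1 \<longrightarrow> h = 1\<close> leaves out exactly these cases.\<close>

theorem lemma4p1:
  fixes E :: "'a set" and p :: real and k h :: nat and D :: "'a set set"
  assumes "finite E"
    and "0 < p" and "p < 1"
    and "k \<ge> 1"
    and "h \<ge> 1"
    and "k = 1 \<longrightarrow> h = 1"
    and "k_exchange_system E k D"
  shows "admits_uniform_exchange_map p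
           (p ^ h / real h)
           (p ^ h / real h * (real k - 1 + 1 / real h)) D"
  unfolding admits_uniform_exchange_map_def
proof (intro ballI)
  fix X Y assume XY: "X \<in> D" "Y \<in> D"
  have fin: "finite (Y - X)" "finite (X - Y)"
    using XY assms(1,7) unfolding k_exchange_system_def by (auto intro: finite_subset)
  have "\<exists>T. (\<forall>y\<in>Y - X. T y \<subseteq> X - Y \<and> card (T y) \<le> k) \<and>
      (\<forall>x\<in>X - Y. card {y \<in> Y - X. x \<in> T y} \<le> k) \<and>
      (\<forall>S. S \<subseteq> Y - X \<longrightarrow> (X \<union> S) - (\<Union>y\<in>S. T y) \<in> D)"
    using XY assms(7) by (simp add: k_exchange_system_def)
  then obtain T where T: "\<And>y. y \<in> Y - X \<Longrightarrow> T y \<subseteq> X - Y" "\<And>y. y \<in> Y - X \<Longrightarrow> card (T y) \<le> k"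
    "\<And>x. x \<in> X - Y \<Longrightarrow> card {y \<in> Y - X. x \<in> T y} \<le> k"
    "\<And>S. S \<subseteq> Y - X \<Longrightarrow> (X \<union> S) - (\<Union>y\<in>S. T y) \<in> D"
    by auto
  obtain I :: "('a \<times> nat) set" and B where IB: "finite I"
    "\<And>i. B i \<subseteq> Y - X" "\<And>i. card (B i) \<le> h"
    "\<And>y. y \<in> Y - X \<Longrightarrow> card {i \<in> I. y \<in> B i} = h"
    "\<And>x. x \<in> X - Y \<Longrightarrow> card {i \<in> I. \<exists>y\<in>B i. x \<in> T y} \<le> (k - 1) * h + 1"
    using exchange_blocks[OF fin _ assms(4-6) T(1-3)] by blast
  \<comment> \<open>The number of blocks that can remove \<open>x\<close>, times the probability of
    a single block, is exactly the required upper bound.\<close>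
  have "real ((k - 1) * h + 1) * (p ^ h / (real h)\<^sup>2) = p ^ h / real h * (real k - 1 + 1 / real h)"
    using assms(4,5) by (simp add: of_nat_diff field_simps power2_eq_square)
  then show "\<exists>M. random_exchange_map D X Y M \<and>
      uniform_exchange_map p (p ^ h / real h) (p ^ h / real h * (real k - 1 + 1 / real h)) X Y M"
    using exchange_map_of_blocks[OF fin(1) assms(2,3,5) IB(1-4) T(1,4) IB(5)] by simp
qed

end
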